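(* Let $\mathcal{H}_1,\mathcal{H}_2$ be finite-dimensional Hilbert spaces, let $\mathcal{H}=\mathcal{H}_1\otimes\mathcal{H}_2$, and let $\rho$ be a state on $\mathcal{H}$, written in the form $\rho=\sum_i\lambda_i\rho_i\rho_i^\dagger$ with $\rho_i\in\mathcal{H}$, $\|\rho_i\|=1$ and $\langle\rho_i,\rho_j\rangle=0$ for $i\neq j$. Then $$\max_{\sigma\in Sep(\mathcal{H})}\langle\rho,\sigma\rangle=\max_{\|x\|=\|y\|=1}\left\|\sum_i\sqrt{\lambda_i}\,\langle\rho_i,x\otimes y\rangle\,\rho_i\right\|^2,$$ where the maximum on the right is over unit vectors $x\in\mathcal{H}_1$, $y\in\mathcal{H}_2$.
   Context: Vectors are column vectors and $^\dagger$ is the conjugate transpose. A state on a finite-dimensional Hilbert space is a hermitian matrix $\rho$ with $\rho\ge0$ (positive semidefinite) and $\mathrm{tr}(\rho)=1$. A state on $\mathcal{H}=\mathcal{H}_1\otimes\mathcal{H}_2$ is separable if it is a convex combination $\sum_i a_i\,v_i\otimes w_i$ where each $v_i$ is a state on $\mathcal{H}_1$ and each $w_i$ is a state on $\mathcal{H}_2$; $Sep(\mathcal{H})$ is the convex set of separable states. On matrices, $\langle\rho,\sigma\rangle=\mathrm{tr}(\rho^\dagger\sigma)$ is the standard inner product; on vectors, $\langle\cdot,\cdot\rangle$ is the inner product of $\mathcal{H}$, with associated norm $\|\cdot\|$. *)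

theory Defs
  imports "HOL-Analysis.Analysis"
begin

(* A finite-dimensional Hilbert space with a chosen orthonormal basis is complex^'n, and the
   tensor product of complex^'m and complex^'n is complex^('m \<times> 'n).  The library norm of
   complex^'n is the Hilbert space norm, but the library inner product on it is only the
   real-valued one, so the complex inner product is defined here.  It is conjugate-linear in
   the first argument, in accordance with <A,B> = tr(A^dagger B). *)
definition cinner :: "complex^'n \<Rightarrow> complex^'n \<Rightarrow> complex" where
  "cinner v w = (\<Sum>i\<in>UNIV. cnj (v $ i) * w $ i)"

definition dagger :: "complex^'n^'m \<Rightarrow> complex^'m^'n" where
  "dagger A = (\<chi> i j. cnj (A $ j $ i))"

definition hs_inner :: "complex^'n^'n \<Rightarrow> complex^'n^'n \<Rightarrow> complex" where
  "hs_inner A B = trace (dagger A ** B)"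

(* The matrix v w^dagger for column vectors v and w. *)
definition outer_prod :: "complex^'m \<Rightarrow> complex^'n \<Rightarrow> complex^'n^'m" where
  "outer_prod v w = (\<chi> i j. v $ i * cnj (w $ j))"

definition tensor_vec :: "complex^'m \<Rightarrow> complex^'n \<Rightarrow> complex^('m \<times> 'n)" where
  "tensor_vec x y = (\<chi> p. x $ fst p * y $ snd p)"

definition tensor_mat ::
    "complex^'m^'m \<Rightarrow> complex^'n^'n \<Rightarrow> complex^('m \<times> 'n)^('m \<times> 'n)" where
  "tensor_mat A B = (\<chi> p q. A $ fst p $ fst q * B $ snd p $ snd q)"

(* The order on complex numbers is that of HOL-Library.Complex_Order: a \<le> b means
   Re a \<le> Re b and Im a = Im b, so 0 \<le> c says that c is real and nonnegative. *)
definition pos_semidef :: "complex^'n^'n \<Rightarrow> bool" where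
  "pos_semidef A \<longleftrightarrow> (\<forall>v. 0 \<le> cinner v (A *v v))"

definition is_state :: "complex^'n^'n \<Rightarrow> bool" where
  "is_state A \<longleftrightarrow> dagger A = A \<and> pos_semidef A \<and> trace A = 1"

definition separable_states :: "(complex^('m::finite \<times> 'n::finite)^('m \<times> 'n)) set" where
  "separable_states = {S. is_state S \<and>
     (\<exists>(k::nat) (a :: nat \<Rightarrow> real) (v :: nat \<Rightarrow> complex^'m^'m) (w :: nat \<Rightarrow> complex^'n^'n).
        (\<forall>i<k. 0 \<le> a i \<and> is_state (v i) \<and> is_state (w i)) \<and>
        (\<Sum>i<k. a i) = 1 \<and>
        S = (\<Sum>i<k. a i *\<^sub>R tensor_mat (v i) (w i)))}"

(* For a set of complex numbers with a real maximum m, this also says that all elements of the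
   set are real. *)
definition is_maximum :: "'a::order set \<Rightarrow> 'a \<Rightarrow> bool" where
  "is_maximum S m \<longleftrightarrow> m \<in> S \<and> (\<forall>s\<in>S. s \<le> m)"

end

theory Submission
  imports Defs
begin

text \<open>On a pure product state \<open>z z\<^sup>\<dagger>\<close> with \<open>z = x \<otimes> y\<close> the functional
  \<open>\<langle>\<rho>, \<cdot>\<rangle>\<close> takes the value \<open>\<Sum>i. \<lambda>\<^sub>i \<bar>\<langle>\<rho>\<^sub>i, z\<rangle>\<bar>\<^sup>2\<close>, which by orthonormality is the
  right-hand side; compactness of the spheres gives a maximum \<open>M\<close>. Every state is a sum of rank-one
  matrices \<open>u u\<^sup>\<dagger>\<close> whose squared norms add up to 1 (by Cholesky elimination, so the spectral theorem
  is not needed), hence every separable state is a convex combination of pure product states and the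
  linear functional is at most \<open>M\<close> on it.\<close>

section \<open>Sesquilinearity of the complex inner product and Pythagoras\<close>

lemma cinner_add_left: "cinner (u + v) w = cinner u w + cinner v w"
  by (simp add: cinner_def distrib_right sum.distrib)

lemma cinner_add_right: "cinner u (v + w) = cinner u v + cinner u w"
  by (simp add: cinner_def distrib_left sum.distrib)

lemma cinner_diff_left: "cinner (u - v) w = cinner u w - cinner v w"
  by (simp add: cinner_def left_diff_distrib sum_subtractf)

lemma cinner_diff_right: "cinner u (v - w) = cinner u v - cinner u w"
  by (simp add: cinner_def right_diff_distrib sum_subtractf)

lemma cinner_scale_left: "cinner (c *s v) w = cnj c * cinner v w"
  by (simp add: cinner_def sum_distrib_left mult.assoc)

lemma cinner_scale_right: "cinner v (c *s w) = c * cinner v w"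
  by (simp add: cinner_def sum_distrib_left mult_ac)

lemma cinner_sum_left: "cinner (\<Sum>i\<in>I. f i) w = (\<Sum>i\<in>I. cinner (f i) w)"
  by (induction I rule: infinite_finite_induct) (simp_all add: cinner_add_left, simp_all add: cinner_def)

lemma cinner_sum_right: "cinner v (\<Sum>i\<in>I. f i) = (\<Sum>i\<in>I. cinner v (f i))"
  by (induction I rule: infinite_finite_induct) (simp_all add: cinner_add_right, simp_all add: cinner_def)

lemma cnj_cinner: "cnj (cinner v w) = cinner w v"
  by (simp add: cinner_def mult.commute)

lemma cinner_self: "cinner v v = complex_of_real ((norm v)\<^sup>2)"
  by (simp add: cinner_def norm_vec_def L2_set_def sum_nonneg mult.commute
      flip: complex_norm_square)

lemma cinner_axis_left: "cinner (axis k 1) w = w $ k"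
proof -
  have "cinner (axis k 1) w = (\<Sum>i\<in>UNIV. if i = k then w $ i else 0)"
    unfolding cinner_def axis_def by (rule sum.cong) auto
  then show ?thesis by simp
qed

lemma mult_vec_axis_component:
  fixes A :: "complex^'n^'m"
  shows "(A *v axis k 1) $ i = A $ i $ k"
proof -
  have "(A *v axis k 1) $ i = (\<Sum>j\<in>UNIV. if j = k then A $ i $ j else 0)"
    unfolding matrix_vector_mult_def axis_def vec_lambda_beta by (rule sum.cong) auto
  then show ?thesis by simp
qed

text \<open>Pythagoras: orthogonality kills the off-diagonal terms of the double sum. It turns the
  squared norm on the right-hand side of the theorem into a weighted sum of squared moduli.\<close>

lemma norm_sum_orthonormal:
  assumes "finite I" and "\<And>i. i \<in> I \<Longrightarrow> norm (r i) = 1"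
    and "\<And>i j. i \<in> I \<Longrightarrow> j \<in> I \<Longrightarrow> i \<noteq> j \<Longrightarrow> cinner (r i) (r j) = 0"
  shows "(norm (\<Sum>i\<in>I. c i *s r i))\<^sup>2 = (\<Sum>i\<in>I. (cmod (c i))\<^sup>2)"
proof -
  have "complex_of_real ((norm (\<Sum>i\<in>I. c i *s r i))\<^sup>2)
      = (\<Sum>i\<in>I. \<Sum>j\<in>I. cnj (c i) * (c j * cinner (r i) (r j)))"
    unfolding cinner_self[symmetric] cinner_sum_left cinner_scale_left
    by (simp add: cinner_sum_right cinner_scale_right sum_distrib_left)
  also have "\<dots> = (\<Sum>i\<in>I. \<Sum>j\<in>I. if j = i then complex_of_real ((cmod (c i))\<^sup>2) else 0)"
    using assms(2,3)
    by (intro sum.cong refl) (auto simp: cinner_self complex_norm_square mult.commute simp del: of_real_power)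
  also have "\<dots> = complex_of_real (\<Sum>i\<in>I. (cmod (c i))\<^sup>2)"
    using assms(1) by simp
  finally show ?thesis by (simp only: of_real_eq_iff)
qed

section \<open>Rank-one matrices and the Hilbert-Schmidt inner product\<close>

lemma outer_prod_mult_vec: "outer_prod u w *v z = cinner w z *s u"
  by (simp add: vec_eq_iff outer_prod_def matrix_vector_mult_def cinner_def
      sum_distrib_left sum_distrib_right mult_ac)

lemma cinner_outer_prod: "cinner z (outer_prod u u *v z) = complex_of_real ((cmod (cinner u z))\<^sup>2)"
  by (simp add: outer_prod_mult_vec cinner_scale_right complex_norm_square cnj_cinner
      del: of_real_power)

lemma trace_outer_prod: "trace (outer_prod u u) = complex_of_real ((norm u)\<^sup>2)"
  unfolding cinner_self[symmetric] by (simp add: trace_def outer_prod_def cinner_def mult.commute)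

lemma is_state_outer_prod:
  assumes "norm u = 1"
  shows "is_state (outer_prod u u)"
proof -
  have "dagger (outer_prod u u) = outer_prod u u"
    by (simp add: dagger_def outer_prod_def vec_eq_iff mult.commute)
  then show ?thesis
    using assms
    by (simp add: is_state_def pos_semidef_def cinner_outer_prod trace_outer_prod less_eq_complex_def)
qed

lemma hs_inner_eq_sum: "hs_inner A B = (\<Sum>i\<in>UNIV. \<Sum>j\<in>UNIV. cnj (A $ j $ i) * B $ j $ i)"
  by (simp add: hs_inner_def trace_def matrix_matrix_mult_def dagger_def)

lemma hs_inner_sum_right: "hs_inner A (\<Sum>i\<in>I. f i) = (\<Sum>i\<in>I. hs_inner A (f i))"
proof (induction I rule: infinite_finite_induct)
  case (insert i I)
  then show ?case
    by (simp add: hs_inner_eq_sum distrib_left sum.distrib)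
qed (simp_all add: hs_inner_eq_sum)

lemma hs_inner_scaleR_right: "hs_inner A (c *\<^sub>R B) = complex_of_real c * hs_inner A B"
  unfolding hs_inner_eq_sum sum_distrib_left vector_scaleR_component
  by (intro sum.cong refl) (simp add: scaleR_conv_of_real)

text \<open>Links the matrix inner product to the quadratic form of \<open>A\<close>. The conjugate
  comes from the dagger on \<open>A\<close>; it disappears in the application, where the form is
  real.\<close>

lemma hs_inner_outer_prod: "hs_inner A (outer_prod z z) = cnj (cinner z (A *v z))"
proof -
  have "cnj (cinner z (A *v z)) = (\<Sum>j\<in>UNIV. \<Sum>i\<in>UNIV. cnj (A $ j $ i) * (z $ j * cnj (z $ i)))"
    by (simp add: cinner_def matrix_vector_mult_def sum_distrib_left mult_ac)
  also have "\<dots> = hs_inner A (outer_prod z z)"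
    unfolding hs_inner_eq_sum by (subst sum.swap) (simp add: outer_prod_def)
  finally show ?thesis by simp
qed

lemma sum_scaleR_mult_vec:
  fixes f :: "'i \<Rightarrow> complex^'n^'m"
  shows "(\<Sum>i\<in>I. l i *\<^sub>R f i) *v z = (\<Sum>i\<in>I. complex_of_real (l i) *s (f i *v z))"
proof (induction I rule: infinite_finite_induct)
  case (insert i I)
  have "(l i *\<^sub>R f i) *v z = complex_of_real (l i) *s (f i *v z)"
    by (simp add: vec_eq_iff matrix_vector_mult_def sum_distrib_left)
       (simp add: scaleR_conv_of_real mult_ac)
  with insert show ?case
    by (simp add: matrix_vector_mult_add_rdistrib)
qed simp_all

text \<open>Serves two purposes: at \<open>z = r j\<close> it isolates the eigenvalue
  \<open>l j\<close>, and at a product vector it evaluates the functional to be maximised.\<close>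

lemma cinner_spectral_sum:
  "cinner z ((\<Sum>i\<in>I. l i *\<^sub>R outer_prod (r i) (r i)) *v z)
    = complex_of_real (\<Sum>i\<in>I. l i * (cmod (cinner (r i) z))\<^sup>2)"
  by (simp add: sum_scaleR_mult_vec cinner_sum_right cinner_scale_right cinner_outer_prod)

section \<open>Hermitian positive semidefinite matrices and Cholesky elimination\<close>

lemma hermitian_component:
  assumes "dagger A = A"
  shows "cnj (A $ i $ j) = A $ j $ i"
  using arg_cong[OF assms, of "\<lambda>B. B $ j $ i"] by (simp add: dagger_def)

lemma dagger_diff: "dagger (A - B) = dagger A - dagger B"
  by (simp add: dagger_def vec_eq_iff)

text \<open>Hermiticity makes the two cross terms conjugate to each other, so their real parts add
  up. The result is a real quadratic in \<open>t\<close>, from which a good choice of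
  \<open>t\<close> extracts inequalities for positive \<open>A\<close>.\<close>

lemma cinner_hermitian_expand:
  assumes "dagger A = A"
  shows "Re (cinner (z - t *s axis k 1) (A *v (z - t *s axis k 1)))
    = Re (cinner z (A *v z)) - 2 * Re (cnj t * (A *v z) $ k) + (cmod t)\<^sup>2 * Re (A $ k $ k)"
proof -
  let ?e = "axis k 1 :: complex^'a"
  have col: "(A *v ?e) = (\<chi> i. A $ i $ k)"
    by (simp add: vec_eq_iff mult_vec_axis_component)
  have ze: "cinner z (A *v ?e) = cnj ((A *v z) $ k)"
    unfolding col by (simp add: cinner_def matrix_vector_mult_def hermitian_component[OF assms] mult.commute)
  have ee: "cinner ?e (A *v ?e) = A $ k $ k"
    by (simp add: cinner_axis_left col)
  have "cinner (z - t *s ?e) (A *v (z - t *s ?e)) =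
     cinner z (A *v z) - t * cnj ((A *v z) $ k) - cnj t * (A *v z) $ k + (cnj t * t) * A $ k $ k"
    by (simp add: vector_scalar_commute cinner_diff_left
        cinner_diff_right cinner_scale_left cinner_scale_right ze ee cinner_axis_left
        mult_vec_axis_component algebra_simps)
  moreover have "cnj t * t = complex_of_real ((cmod t)\<^sup>2)"
    by (simp only: complex_norm_square mult.commute)
  ultimately show ?thesis
    by (simp del: of_real_power matrix_vector_mult_diff_distrib add: mult.commute)
qed

lemma pos_semidefD: "pos_semidef A \<Longrightarrow> 0 \<le> Re (cinner v (A *v v))"
  unfolding pos_semidef_def less_eq_complex_def by (metis zero_complex.sel(1))

text \<open>The quadratic form of a hermitian matrix equals its own conjugate and is therefore real,
  so only its real part has to be tested.\<close>

lemma pos_semidef_hermitianI: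
  assumes "dagger A = A" and "\<And>v. 0 \<le> Re (cinner v (A *v v))"
  shows "pos_semidef A"
proof -
  have "Im (cinner v (A *v v)) = 0" for v
  proof -
    have "cnj (cinner v (A *v v)) = hs_inner A (outer_prod v v)"
      by (simp add: hs_inner_outer_prod)
    also have "\<dots> = (\<Sum>i\<in>UNIV. \<Sum>j\<in>UNIV. A $ i $ j * (v $ j * cnj (v $ i)))"
      by (simp add: hs_inner_eq_sum outer_prod_def hermitian_component[OF assms(1)])
    also have "\<dots> = cinner v (A *v v)"
      by (simp add: cinner_def matrix_vector_mult_def sum_distrib_left mult_ac)
    finally have "Im (cnj (cinner v (A *v v))) = Im (cinner v (A *v v))" by (rule arg_cong)
    then show ?thesis unfolding cnj.simps(2) by linarith
  qed
  with assms(2) show ?thesis by (simp add: pos_semidef_def less_eq_complex_def)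
qed

text \<open>Take \<open>u\<close> to be column \<open>k\<close> divided by the square root of the \<open>k\<close>-th diagonal entry, which leaves
  the Schur complement; if that entry vanishes, so does its row, by positivity, and \<open>u = 0\<close> works.\<close>
lemma psd_clear_row:
  fixes A :: "complex^'n^'n"
  assumes herm: "dagger A = A" and psd: "pos_semidef A"
  obtains u where "dagger (A - outer_prod u u) = A - outer_prod u u"
    and "pos_semidef (A - outer_prod u u)"
    and "(A - outer_prod u u) $ k = 0"
    and "\<And>i. A $ i = 0 \<Longrightarrow> (A - outer_prod u u) $ i = 0"
proof -
  define b where "b = Re (A $ k $ k)"
  have pos: "0 \<le> Re (cinner v (A *v v))" for v
    using psd by (rule pos_semidefD)
  \<comment> \<open>Positivity at \<open>z - t *s axis k 1\<close> for arbitrary complex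
    \<open>t\<close>; each of the two cases below makes its own choice of \<open>t\<close>.\<close>
  have key: "0 \<le> Re (cinner z (A *v z)) - 2 * Re (cnj t * (A *v z) $ k) + (cmod t)\<^sup>2 * b" for z t
    using pos[of "z - t *s axis k 1"] unfolding cinner_hermitian_expand[OF herm] b_def .
  have Akk: "A $ k $ k = complex_of_real b"
    using hermitian_component[OF herm, of k k] by (auto simp: b_def complex_eq_iff)
  have "b = Re (cinner (axis k 1) (A *v axis k 1))"
    by (simp add: cinner_axis_left mult_vec_axis_component b_def)
  then have "b \<ge> 0" using pos by simp
  show thesis
  proof (cases "b = 0")
    case True
    have "(A *v z) $ k = 0" for z
    proof (rule ccontr)
      let ?s = "(A *v z) $ k"
      assume nz: "?s \<noteq> 0"
      \<comment> \<open>With \<open>b = 0\<close> the quadratic has no second-order term, so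
        \<open>t = n * ?s\<close> with \<open>n\<close> large makes it negative: the linear term is
        then \<open>- 2 * n * (cmod ?s)\<^sup>2\<close>.\<close>
      obtain n :: nat where n: "Re (cinner z (A *v z)) < real n * (cmod ?s)\<^sup>2"
        using nz reals_Archimedean3[of "(cmod ?s)\<^sup>2"] by auto
      have "cnj (complex_of_real n * ?s) * ?s = complex_of_real (real n * (cmod ?s)\<^sup>2)"
        by (simp add: complex_norm_square mult_ac del: of_real_power)
      then have "Re (cnj (complex_of_real n * ?s) * ?s) = real n * (cmod ?s)\<^sup>2"
        by (simp only: Re_complex_of_real)
      with key[of z "complex_of_real n * ?s"] n pos[of z] True show False
        by simp
    qed
    from this[of "axis j 1" for j] have "A $ k = 0"
      by (simp add: vec_eq_iff mult_vec_axis_component)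
    moreover have "outer_prod (0 :: complex^'n) (0 :: complex^'n) = 0"
      by (simp add: outer_prod_def vec_eq_iff)
    ultimately show thesis
      using that[of 0] herm psd by simp
  next
    case False
    with \<open>b \<ge> 0\<close> have b: "b > 0" by simp
    define u :: "complex^'n" where "u = (\<chi> i. A $ i $ k / complex_of_real (sqrt b))"
    have outer: "outer_prod u u $ i $ j = A $ i $ k * A $ k $ j / complex_of_real b" for i j
      using b by (simp add: outer_prod_def u_def hermitian_component[OF herm] flip: of_real_mult)
    have herm': "dagger (A - outer_prod u u) = A - outer_prod u u"
      using herm by (simp add: dagger_diff) (simp add: dagger_def outer_prod_def vec_eq_iff mult.commute)
    have "0 \<le> Re (cinner z ((A - outer_prod u u) *v z))" for z
    proof -
      let ?s = "(A *v z) $ k"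
      have "cinner u z = ?s / complex_of_real (sqrt b)"
        by (simp add: cinner_def u_def matrix_vector_mult_def hermitian_component[OF herm]
            sum_divide_distrib)
      then have uz: "(cmod (cinner u z))\<^sup>2 = (cmod ?s)\<^sup>2 / b"
        using b by (simp add: norm_divide power_divide)
      \<comment> \<open>The choice \<open>t = ?s / b\<close> minimises the quadratic in
        \<open>key\<close>. The minimum is the form of \<open>A\<close> minus
        \<open>(cmod ?s)\<^sup>2 / b\<close>, which is exactly the form of the Schur
        complement.\<close>
      have "cnj (?s / complex_of_real b) * ?s = complex_of_real ((cmod ?s)\<^sup>2 / b)"
        by (simp add: complex_norm_square mult_ac del: of_real_power)
      then have "Re (cnj (?s / complex_of_real b) * ?s) = (cmod ?s)\<^sup>2 / b"
        by (simp only: Re_complex_of_real)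
      moreover have "(cmod (?s / complex_of_real b))\<^sup>2 * b = (cmod ?s)\<^sup>2 / b"
        using b by (simp add: norm_divide power_divide power2_eq_square)
      ultimately have "(cmod ?s)\<^sup>2 / b \<le> Re (cinner z (A *v z))"
        using key[of z "?s / complex_of_real b"] by linarith
      then show ?thesis
        by (simp add: matrix_vector_mult_diff_rdistrib cinner_diff_right cinner_outer_prod uz
            del: of_real_power)
    qed
    with herm' have psd': "pos_semidef (A - outer_prod u u)"
      by (rule pos_semidef_hermitianI)
    show thesis
    proof (rule that[OF herm' psd'])
      show "(A - outer_prod u u) $ k = 0"
        using b by (simp add: vec_eq_iff outer Akk)
      show "(A - outer_prod u u) $ i = 0" if "A $ i = 0" for i
        using that by (simp add: vec_eq_iff outer)
    qed
  qed
qed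

text \<open>Rows are cleared one after another, each at the cost of one rank-one matrix, until the
  remainder is zero. The vectors \<open>u k\<close> need not be normalised or orthogonal, and some
  may vanish.\<close>

lemma psd_eq_sum_outer_prod:
  fixes A :: "complex^'n^'n"
  assumes "dagger A = A" and "pos_semidef A"
  obtains u :: "'n \<Rightarrow> complex^'n" where "A = (\<Sum>k\<in>UNIV. outer_prod (u k) (u k))"
proof -
  define R where "R S u = A - (\<Sum>k\<in>S. outer_prod (u k) (u k))"
    for S :: "'n set" and u :: "'n \<Rightarrow> complex^'n"
  \<comment> \<open>Invariant: the remainder \<open>R S u\<close> stays hermitian and positive
    semidefinite, and its rows indexed by \<open>S\<close> are already zero. Clearing a further row
    does not refill them.\<close>
  have "finite S \<Longrightarrow> \<exists>u. dagger (R S u) = R S u \<and> pos_semidef (R S u) \<and> (\<forall>i\<in>S. R S u $ i = 0)" for S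
  proof (induction S rule: finite_induct)
    case empty
    then show ?case using assms by (simp add: R_def)
  next
    case (insert k S)
    then obtain u where u: "dagger (R S u) = R S u" "pos_semidef (R S u)" "\<forall>i\<in>S. R S u $ i = 0"
      by blast
    obtain w where w: "dagger (R S u - outer_prod w w) = R S u - outer_prod w w"
      "pos_semidef (R S u - outer_prod w w)" "(R S u - outer_prod w w) $ k = 0"
      "\<And>i. R S u $ i = 0 \<Longrightarrow> (R S u - outer_prod w w) $ i = 0"
      by (rule psd_clear_row[OF u(1,2), of k]) blast
    \<comment> \<open>Since \<open>k\<close> is not in \<open>S\<close>, assigning the new vector
      \<open>w\<close> to \<open>k\<close> leaves the earlier summands intact.\<close>
    have "(\<Sum>j\<in>S. outer_prod ((u(k := w)) j) ((u(k := w)) j)) = (\<Sum>j\<in>S. outer_prod (u j) (u j))"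
      using insert.hyps by (intro sum.cong refl) auto
    then have eq: "R (insert k S) (u(k := w)) = R S u - outer_prod w w"
      unfolding R_def using insert.hyps by simp
    have "\<forall>i\<in>insert k S. R (insert k S) (u(k := w)) $ i = 0"
      unfolding eq using w(3,4) u(3) by blast
    with w(1,2) show ?case
      by (metis eq)
  qed
  from this[OF finite_class.finite_UNIV] obtain u where "\<forall>i\<in>UNIV. R UNIV u $ i = 0"
    by blast
  then have "R UNIV u = 0"
    by (simp add: vec_eq_iff)
  then have "A = (\<Sum>k\<in>UNIV. outer_prod (u k) (u k))"
    by (simp add: R_def)
  then show thesis using that by simp
qed

text \<open>Taking traces in the Cholesky decomposition turns the squared norms into convex
  weights.\<close>

lemma state_eq_sum_outer_prod:
  fixes A :: "complex^'n^'n"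
  assumes "is_state A"
  obtains u :: "'n \<Rightarrow> complex^'n" where "A = (\<Sum>k\<in>UNIV. outer_prod (u k) (u k))"
    and "(\<Sum>k\<in>UNIV. (norm (u k))\<^sup>2) = 1"
proof -
  obtain u :: "'n \<Rightarrow> complex^'n" where u: "A = (\<Sum>k\<in>UNIV. outer_prod (u k) (u k))"
    using assms psd_eq_sum_outer_prod unfolding is_state_def by metis
  have "complex_of_real (\<Sum>k\<in>UNIV. (norm (u k))\<^sup>2) = (\<Sum>k\<in>UNIV. trace (outer_prod (u k) (u k)))"
    by (simp add: trace_outer_prod)
  also have "\<dots> = trace A"
    unfolding u trace_def by (subst sum.swap) simp
  also have "\<dots> = complex_of_real 1" using assms by (simp add: is_state_def)
  finally show thesis using that u by (simp only: of_real_eq_iff)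
qed

section \<open>Tensor products and pure product states\<close>

lemma tensor_mat_outer_prod:
  "tensor_mat (outer_prod x x) (outer_prod y y) = outer_prod (tensor_vec x y) (tensor_vec x y)"
  by (simp add: tensor_mat_def outer_prod_def tensor_vec_def vec_eq_iff mult_ac)

lemma tensor_mat_sum:
  fixes f :: "'i \<Rightarrow> complex^'m^'m" and g :: "'j \<Rightarrow> complex^'n^'n"
  shows "tensor_mat (\<Sum>i\<in>I. f i) (\<Sum>j\<in>J. g j) = (\<Sum>i\<in>I. \<Sum>j\<in>J. tensor_mat (f i) (g j))"
  by (simp add: tensor_mat_def vec_eq_iff sum_product)

lemma norm_tensor_vec: "norm (tensor_vec x y) = norm x * norm y"
proof -
  have "(norm (tensor_vec x y))\<^sup>2 = (\<Sum>p\<in>UNIV. (cmod (x $ fst p))\<^sup>2 * (cmod (y $ snd p))\<^sup>2)"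
    by (simp add: norm_vec_def L2_set_def tensor_vec_def sum_nonneg norm_mult power_mult_distrib)
  also have "\<dots> = (norm x * norm y)\<^sup>2"
    by (simp add: norm_vec_def L2_set_def sum_nonneg power_mult_distrib sum_product
        sum.cartesian_product case_prod_beta)
  finally show ?thesis by simp
qed

lemma tensor_vec_scaleR: "tensor_vec (a *\<^sub>R x) (b *\<^sub>R y) = complex_of_real (a * b) *s tensor_vec x y"
  unfolding tensor_vec_def vec_eq_iff vector_scaleR_component
  by (simp add: scaleR_conv_of_real mult_ac)

lemma outer_prod_tensor_vec_separable:
  fixes x :: "complex^'m::finite" and y :: "complex^'n::finite"
  assumes "norm x = 1" and "norm y = 1"
  shows "outer_prod (tensor_vec x y) (tensor_vec x y) \<in> separable_states"
proof -
  have "is_state (outer_prod (tensor_vec x y) (tensor_vec x y))"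
    using assms by (intro is_state_outer_prod) (simp add: norm_tensor_vec)
  moreover have "\<exists>(k::nat) (a :: nat \<Rightarrow> real) (v :: nat \<Rightarrow> complex^'m^'m) (w :: nat \<Rightarrow> complex^'n^'n).
        (\<forall>i<k. 0 \<le> a i \<and> is_state (v i) \<and> is_state (w i)) \<and> (\<Sum>i<k. a i) = 1 \<and>
        outer_prod (tensor_vec x y) (tensor_vec x y) = (\<Sum>i<k. a i *\<^sub>R tensor_mat (v i) (w i))"
    using assms
    \<comment> \<open>A convex combination with a single term of weight 1.\<close>
    by (intro exI[of _ 1] exI[of _ "\<lambda>_. 1"] exI[of _ "\<lambda>_. outer_prod x x"]
        exI[of _ "\<lambda>_. outer_prod y y"])
      (simp add: is_state_outer_prod tensor_mat_outer_prod)
  ultimately show ?thesis by (simp add: separable_states_def)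
qed

section \<open>Maximisation over product vectors and over separable states\<close>

lemma continuous_on_tensor_form:
  fixes r :: "'i \<Rightarrow> complex^('m::finite \<times> 'n::finite)"
  shows "continuous_on UNIV
    (\<lambda>p :: (complex^'m) \<times> (complex^'n).
      \<Sum>i\<in>I. l i * (cmod (cinner (r i) (tensor_vec (fst p) (snd p))))\<^sup>2)"
  unfolding cinner_def tensor_vec_def vec_lambda_beta by (intro continuous_intros)

text \<open>Compactness of the product of unit spheres gives the maximiser. The form is homogeneous
  of degree two in each factor, so the bound extends to all vectors; this lets it be applied
  directly to the unnormalised vectors of a Cholesky decomposition.\<close>

lemma tensor_form_attains_max:
  fixes r :: "'i \<Rightarrow> complex^('m::finite \<times> 'n::finite)"
  obtains x0 :: "complex^'m" and y0 :: "complex^'n" where "norm x0 = 1" "norm y0 = 1"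
    "\<And>x y. (\<Sum>i\<in>I. l i * (cmod (cinner (r i) (tensor_vec x y)))\<^sup>2)
      \<le> (\<Sum>i\<in>I. l i * (cmod (cinner (r i) (tensor_vec x0 y0)))\<^sup>2) * ((norm x)\<^sup>2 * (norm y)\<^sup>2)"
proof -
  define f where "f x y = (\<Sum>i\<in>I. l i * (cmod (cinner (r i) (tensor_vec x y)))\<^sup>2)" for x y
  let ?S = "sphere 0 1 \<times> sphere 0 1 :: ((complex^'m) \<times> (complex^'n)) set"
  have "compact ?S" by (intro compact_Times compact_sphere)
  moreover have "?S \<noteq> {}"
  proof -
    have "(axis a 1, axis b 1) \<in> ?S" for a b by (simp add: norm_axis_1)
    then show ?thesis by blast
  qed
  moreover have "continuous_on ?S (\<lambda>p. f (fst p) (snd p))"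
    unfolding f_def by (rule continuous_on_subset[OF continuous_on_tensor_form]) simp
  ultimately obtain p where p: "p \<in> ?S" "\<forall>q\<in>?S. f (fst q) (snd q) \<le> f (fst p) (snd p)"
    using continuous_attains_sup by blast
  have scale: "f (a *\<^sub>R x) (b *\<^sub>R y) = (a\<^sup>2 * b\<^sup>2) * f x y" for a b x y
    by (simp add: f_def tensor_vec_scaleR cinner_scale_right norm_mult power_mult_distrib
        sum_distrib_left mult_ac)
  have "f x y \<le> f (fst p) (snd p) * ((norm x)\<^sup>2 * (norm y)\<^sup>2)" for x y
  proof (cases "x = 0 \<or> y = 0")
    case True
    \<comment> \<open>Scaling a factor by 0 shows that the form vanishes when that factor is the
      zero vector.\<close>
    with scale[of 0 x 1 y] scale[of 1 x 0 y] show ?thesis by auto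
  next
    case False
    then have "f (sgn x) (sgn y) \<le> f (fst p) (snd p)"
      using p(2) by (auto simp: norm_sgn)
    moreover have "f x y = ((norm x)\<^sup>2 * (norm y)\<^sup>2) * f (sgn x) (sgn y)"
      using False by (subst scale[symmetric]) (simp add: sgn_div_norm)
    ultimately show ?thesis
      using mult_right_mono[of "f (sgn x) (sgn y)" "f (fst p) (snd p)" "(norm x)\<^sup>2 * (norm y)\<^sup>2"]
      by (simp add: mult.commute)
  qed
  moreover have "norm (fst p) = 1" "norm (snd p) = 1" using p(1) by (auto simp: mem_Times_iff)
  ultimately show thesis using that unfolding f_def by blast
qed

text \<open>Expanding both factors of a product state into rank-one matrices gives terms bounded by
  \<open>M\<close> times the weights \<open>(norm (a i))\<^sup>2 * (norm (b j))\<^sup>2\<close>,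
  which sum to 1. Convexity then passes from product states to separable ones. In the complex order
  the conclusion also says that the value is real.\<close>

lemma hs_inner_separable_le:
  fixes A :: "complex^('m::finite \<times> 'n::finite)^('m \<times> 'n)"
  assumes sep: "\<sigma> \<in> separable_states"
    and bound: "\<And>x y. hs_inner A (outer_prod (tensor_vec x y) (tensor_vec x y))
      \<le> complex_of_real (M * ((norm x)\<^sup>2 * (norm y)\<^sup>2))"
  shows "hs_inner A \<sigma> \<le> complex_of_real M"
proof -
  have prod: "hs_inner A (tensor_mat v w) \<le> complex_of_real M" if "is_state v" "is_state w" for v w
  proof -
    obtain a :: "'m \<Rightarrow> complex^'m" where a: "v = (\<Sum>k\<in>UNIV. outer_prod (a k) (a k))" "(\<Sum>k\<in>UNIV. (norm (a k))\<^sup>2) = 1"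
      by (rule state_eq_sum_outer_prod[OF \<open>is_state v\<close>])
    obtain b :: "'n \<Rightarrow> complex^'n" where b: "w = (\<Sum>k\<in>UNIV. outer_prod (b k) (b k))" "(\<Sum>k\<in>UNIV. (norm (b k))\<^sup>2) = 1"
      by (rule state_eq_sum_outer_prod[OF \<open>is_state w\<close>])
    have "hs_inner A (tensor_mat v w) = (\<Sum>i\<in>UNIV. \<Sum>j\<in>UNIV.
        hs_inner A (outer_prod (tensor_vec (a i) (b j)) (tensor_vec (a i) (b j))))"
      by (simp add: a(1) b(1) tensor_mat_sum tensor_mat_outer_prod hs_inner_sum_right)
    also have "\<dots> \<le> (\<Sum>i\<in>UNIV. \<Sum>j\<in>UNIV. complex_of_real (M * ((norm (a i))\<^sup>2 * (norm (b j))\<^sup>2)))"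
      by (intro sum_mono bound)
    also have "\<dots> = complex_of_real (M * ((\<Sum>i\<in>UNIV. (norm (a i))\<^sup>2) * (\<Sum>j\<in>UNIV. (norm (b j))\<^sup>2)))"
      unfolding sum_product unfolding sum_distrib_left of_real_sum ..
    also have "\<dots> = complex_of_real M" using a(2) b(2) by simp
    finally show ?thesis .
  qed
  obtain k :: nat and c :: "nat \<Rightarrow> real" and v :: "nat \<Rightarrow> complex^'m^'m" and w :: "nat \<Rightarrow> complex^'n^'n"
    where c: "\<forall>i<k. 0 \<le> c i \<and> is_state (v i) \<and> is_state (w i)" "(\<Sum>i<k. c i) = 1"
      and \<sigma>: "\<sigma> = (\<Sum>i<k. c i *\<^sub>R tensor_mat (v i) (w i))"
    using sep unfolding separable_states_def by blast
  have "hs_inner A \<sigma> = (\<Sum>i<k. complex_of_real (c i) * hs_inner A (tensor_mat (v i) (w i)))"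
    by (simp add: \<sigma> hs_inner_sum_right hs_inner_scaleR_right)
  also have "\<dots> \<le> (\<Sum>i<k. complex_of_real (c i) * complex_of_real M)"
  proof (rule sum_mono)
    fix i assume "i \<in> {..<k}"
    with c(1) prod[of "v i" "w i"]
    show "complex_of_real (c i) * hs_inner A (tensor_mat (v i) (w i)) \<le> complex_of_real (c i) * complex_of_real M"
      by (simp add: less_eq_complex_def mult_left_mono)
  qed
  also have "\<dots> = complex_of_real M"
    using c(2) by (simp flip: sum_distrib_right of_real_sum)
  finally show ?thesis .
qed

section \<open>Equality of the maxima over separable states and over unit product vectors\<close>

theorem mainTheorem7:
  fixes \<rho> :: "complex^('m::finite \<times> 'n::finite)^('m \<times> 'n)"
    and I :: "'i set"
    and l :: "'i \<Rightarrow> real"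
    and r :: "'i \<Rightarrow> complex^('m \<times> 'n)"
  assumes "is_state \<rho>"
    and "finite I"
    and "\<rho> = (\<Sum>i\<in>I. l i *\<^sub>R outer_prod (r i) (r i))"
    and "\<And>i. i \<in> I \<Longrightarrow> norm (r i) = 1"
    and "\<And>i j. i \<in> I \<Longrightarrow> j \<in> I \<Longrightarrow> i \<noteq> j \<Longrightarrow> cinner (r i) (r j) = 0"
  shows "\<exists>M::real.
    is_maximum {hs_inner \<rho> \<sigma> | \<sigma>. \<sigma> \<in> separable_states} (complex_of_real M) \<and>
    is_maximum
      {(norm (\<Sum>i\<in>I. (complex_of_real (sqrt (l i)) * cinner (r i) (tensor_vec x y)) *s r i))\<^sup>2
        | (x :: complex^'m) (y :: complex^'n). norm x = 1 \<and> norm y = 1} M"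
proof -
  define f where "f x y = (\<Sum>i\<in>I. l i * (cmod (cinner (r i) (tensor_vec x y)))\<^sup>2)"
    for x :: "complex^'m" and y :: "complex^'n"
  \<comment> \<open>By orthonormality \<open>l j\<close> is the value of the form of
    \<open>\<rho>\<close> at \<open>r j\<close>. Its sign matters because the squared modulus of
    \<open>sqrt (l j)\<close> is the absolute value of \<open>l j\<close>.\<close>
  have l_nonneg: "l j \<ge> 0" if "j \<in> I" for j
  proof -
    have "cinner (r j) (\<rho> *v r j) = complex_of_real (\<Sum>i\<in>I. l i * (cmod (cinner (r i) (r j)))\<^sup>2)"
      unfolding assms(3) by (rule cinner_spectral_sum)
    moreover have "(\<Sum>i\<in>I. l i * (cmod (cinner (r i) (r j)))\<^sup>2) = (\<Sum>i\<in>I. if i = j then l i else 0)"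
      using assms(4,5) that by (intro sum.cong refl) (auto simp: cinner_self)
    ultimately have "cinner (r j) (\<rho> *v r j) = complex_of_real (l j)"
      using assms(2) that by simp
    with assms(1) show ?thesis
      unfolding is_state_def pos_semidef_def by (metis Re_complex_of_real less_eq_complex_def zero_complex.sel(1))
  qed
  have rhs: "(norm (\<Sum>i\<in>I. (complex_of_real (sqrt (l i)) * cinner (r i) (tensor_vec x y)) *s r i))\<^sup>2 = f x y"
    for x y
    using l_nonneg
    by (simp add: norm_sum_orthonormal[OF assms(2,4,5)] f_def norm_mult power_mult_distrib)
  have lhs: "hs_inner \<rho> (outer_prod (tensor_vec x y) (tensor_vec x y)) = complex_of_real (f x y)"
    for x y
    by (simp only: hs_inner_outer_prod assms(3) cinner_spectral_sum complex_cnj_complex_of_real f_def)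
  obtain x0 y0 where n0: "norm x0 = 1" "norm y0 = 1"
    and max: "\<And>x y. f x y \<le> f x0 y0 * ((norm x)\<^sup>2 * (norm y)\<^sup>2)"
    using tensor_form_attains_max[where I = I and l = l and r = r] unfolding f_def by blast
  \<comment> \<open>The maximum over separable states is attained at the pure product state of the
    maximising unit vectors.\<close>
  have "complex_of_real (f x0 y0) \<in> {hs_inner \<rho> \<sigma> | \<sigma>. \<sigma> \<in> separable_states}"
    using outer_prod_tensor_vec_separable[OF n0] lhs[of x0 y0] by (metis (mono_tags, lifting) mem_Collect_eq)
  moreover have "hs_inner \<rho> \<sigma> \<le> complex_of_real (f x0 y0)" if "\<sigma> \<in> separable_states" for \<sigma>
    using that by (rule hs_inner_separable_le) (simp add: lhs less_eq_complex_def max del: of_real_mult)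
  moreover have "f x y \<le> f x0 y0" if "norm x = 1" "norm y = 1" for x y
    using max[of x y] that by simp
  ultimately show ?thesis
    unfolding is_maximum_def rhs using n0 by (intro exI[of _ "f x0 y0"]) blast
qed

end
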